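(* Let $L$ be an involutive division on $\mathbb{M}$, let $\succ$ be an admissible monomial ordering, and let $F\subset R$ be a finite $L$-autoreduced set. Then the $L$-normal form modulo $F$, for an arbitrary algorithm of its computation and for any polynomials $p_1,p_2,p\in R$, has the following properties. (i) Uniqueness: if $h_1=NF_L(p,F)$ and $h_2=NF_L(p,F)$ are two $L$-normal forms of $p$ modulo $F$, then $h_1=h_2$. (ii) Linearity: $NF_L(p_1+p_2,F)=NF_L(p_1,F)+NF_L(p_2,F)$.
   Context: $R=K[x_1,\dots,x_n]$ with $K$ a field of characteristic zero; $\mathbb{M}$ is the monoid of monomials. $\succ$ is an admissible monomial ordering with $x_1\succ\cdots\succ x_n$; $lt(f)$, $lc(f)$, $lm(f)=lt(f)/lc(f)$ are the leading term, leading coefficient and leading monomial of $f$; $lm(F)=\{lm(f)\mid f\in F\}$. Involutive division: $L$ is given if for any finite $U\subset\mathbb{M}$ and any $u\in U$ there is given a submonoid $L(u,U)$ of $\mathbb{M}$ such that (a) if $w\in L(u,U)$ and $v\mid w$, then $v\in L(u,U)$; (b) if $u,v\in U$ and $uL(u,U)\cap vL(v,U)\ne\emptyset$, then $u\in vL(v,U)$ or $v\in uL(u,U)$; (c) if $v\in U$ and $v\in uL(u,U)$, then $L(v,U)\subseteq L(u,U)$; (d) if $V\subseteq U$, then $L(u,U)\subseteq L(u,V)$ for all $u\in V$. For $u\in U$, $u|_L w$ means $w\in uL(u,U)$. The involutive cone is $C_L(U)=\bigcup_{u\in U}uL(u,U)$. $U$ is $L$-autoreduced if no element of $U$ is $L$-divisible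 (w.r.t. $U$) by another element of $U$. $L$-autoreduced polynomial set: a finite set $F$ of nonzero polynomials with pairwise distinct leading monomials such that $lm(F)$ is $L$-autoreduced and no $f\in F$ has a term with nonzero coefficient, other than $lt(f)$, whose monomial lies in $C_L(lm(F))$. Involutive reduction: $p$ is $L$-reducible modulo $f\in F$ if $p$ has a term $a\,u$ ($a\in K$, $a\neq0$, $u\in\mathbb{M}$) with $u=lm(f)v$, $v\in L(lm(f),lm(F))$; the corresponding $L$-reduction is $p\to p-(a/lc(f))\,f v$. $p$ is in $L$-normal form modulo $F$ if it is not $L$-reducible modulo any $f\in F$. $NF_L(p,F)$ denotes an $L$-normal form of $p$ modulo $F$, i.e. a polynomial in $L$-normal form modulo $F$ obtained from $p$ by a finite chain of $L$-reductions modulo $F$, chosen by an arbitrary algorithm. *)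

theory Defs
  imports Complex_Main "HOL-Library.Poly_Mapping"
begin

text \<open>
  A monomial in the variables indexed by \<open>'n\<close> is represented by its exponent vector, so the
  monoid of monomials is written additively: the product of \<open>u\<close> and \<open>v\<close> is \<open>u + v\<close> and the
  monomial 1 is \<open>0\<close>. The index type is finite and linearly ordered; its least element
  plays the role of the index 1, its greatest element that of the index \<open>n\<close>. The
  multiplication of \<open>('n, 'k) mpoly\<close> is the convolution product of \<open>Poly_Mapping\<close>.
\<close>

type_synonym 'n monomial = "'n \<Rightarrow>\<^sub>0 nat"
type_synonym ('n, 'k) mpoly = "'n monomial \<Rightarrow>\<^sub>0 'k"

definition mon_dvd :: "'n monomial \<Rightarrow> 'n monomial \<Rightarrow> bool" where
  "mon_dvd v w \<longleftrightarrow> (\<exists>t. w = v + t)"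

definition submonoid :: "'n monomial set \<Rightarrow> bool" where
  "submonoid S \<longleftrightarrow> 0 \<in> S \<and> (\<forall>u\<in>S. \<forall>v\<in>S. u + v \<in> S)"


subsection \<open>Monomial orderings and leading data\<close>

text \<open>\<open>gt u v\<close> stands for \<open>u \<succ> v\<close> (strict).\<close>

definition admissible_ordering :: "('n monomial \<Rightarrow> 'n monomial \<Rightarrow> bool) \<Rightarrow> bool" where
  "admissible_ordering gt \<longleftrightarrow>
     irreflp gt \<and> transp gt \<and> totalp gt \<and>
     (\<forall>u. u \<noteq> 0 \<longrightarrow> gt u 0) \<and>
     (\<forall>u v w. gt u v \<longrightarrow> gt (u + w) (v + w))"

definition variables_decreasing ::
    "('n::linorder monomial \<Rightarrow> 'n monomial \<Rightarrow> bool) \<Rightarrow> bool" where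
  "variables_decreasing gt \<longleftrightarrow>
     (\<forall>i j. i < j \<longrightarrow> gt (Poly_Mapping.single i 1) (Poly_Mapping.single j 1))"

text \<open>Meaningful for nonzero \<open>f\<close> only.\<close>

definition lm :: "('n monomial \<Rightarrow> 'n monomial \<Rightarrow> bool) \<Rightarrow> ('n, 'k::zero) mpoly \<Rightarrow> 'n monomial" where
  "lm gt f = (THE u. u \<in> Poly_Mapping.keys f \<and> (\<forall>v\<in>Poly_Mapping.keys f. v \<noteq> u \<longrightarrow> gt u v))"

definition lc :: "('n monomial \<Rightarrow> 'n monomial \<Rightarrow> bool) \<Rightarrow> ('n, 'k::zero) mpoly \<Rightarrow> 'k" where
  "lc gt f = Poly_Mapping.lookup f (lm gt f)"


subsection \<open>Involutive divisions\<close>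

text \<open>
  \<open>L u U\<close> is constrained only for finite \<open>U\<close> and \<open>u \<in> U\<close>. The set \<open>inv_cone L U u\<close> is
  \<open>u L(u,U)\<close>, i.e. the set of all \<open>w\<close> such that \<open>u\<close> divides \<open>w\<close> involutively with respect to \<open>U\<close>.
\<close>

type_synonym 'n division = "'n monomial \<Rightarrow> 'n monomial set \<Rightarrow> 'n monomial set"

definition inv_cone :: "'n division \<Rightarrow> 'n monomial set \<Rightarrow> 'n monomial \<Rightarrow> 'n monomial set" where
  "inv_cone L U u = {u + v | v. v \<in> L u U}"

definition inv_cones :: "'n division \<Rightarrow> 'n monomial set \<Rightarrow> 'n monomial set" where
  "inv_cones L U = (\<Union>u\<in>U. inv_cone L U u)"

definition involutive_division :: "'n division \<Rightarrow> bool" where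
  "involutive_division L \<longleftrightarrow>
     (\<forall>U. finite U \<longrightarrow>
        (\<forall>u\<in>U. submonoid (L u U)) \<and>
        (\<forall>u\<in>U. \<forall>w\<in>L u U. \<forall>v. mon_dvd v w \<longrightarrow> v \<in> L u U) \<and>
        (\<forall>u\<in>U. \<forall>v\<in>U. inv_cone L U u \<inter> inv_cone L U v \<noteq> {} \<longrightarrow>
            u \<in> inv_cone L U v \<or> v \<in> inv_cone L U u) \<and>
        (\<forall>u\<in>U. \<forall>v\<in>U. v \<in> inv_cone L U u \<longrightarrow> L v U \<subseteq> L u U) \<and>
        (\<forall>V. V \<subseteq> U \<longrightarrow> (\<forall>u\<in>V. L u U \<subseteq> L u V)))"

definition autoreduced_monomials :: "'n division \<Rightarrow> 'n monomial set \<Rightarrow> bool" where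
  "autoreduced_monomials L U \<longleftrightarrow> (\<forall>u\<in>U. \<forall>v\<in>U. v \<noteq> u \<longrightarrow> u \<notin> inv_cone L U v)"

definition autoreduced ::
    "'n division \<Rightarrow> ('n monomial \<Rightarrow> 'n monomial \<Rightarrow> bool) \<Rightarrow> ('n, 'k::zero) mpoly set \<Rightarrow> bool" where
  "autoreduced L gt F \<longleftrightarrow>
     finite F \<and> 0 \<notin> F \<and> inj_on (lm gt) F \<and>
     autoreduced_monomials L (lm gt ` F) \<and>
     (\<forall>f\<in>F. \<forall>u\<in>Poly_Mapping.keys f. u \<noteq> lm gt f \<longrightarrow> u \<notin> inv_cones L (lm gt ` F))"


subsection \<open>Involutive reduction and normal forms\<close>

text \<open>
  \<open>reduces_at L gt F f v p\<close>: the polynomial \<open>p\<close> contains the monomial \<open>lm f \<cdot> v\<close> with a nonzero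
  coefficient, where \<open>v \<in> L(lm f, lm F)\<close>; \<open>reduct gt f v p\<close> is the result of eliminating it.
\<close>

definition reduces_at :: "'n division \<Rightarrow> ('n monomial \<Rightarrow> 'n monomial \<Rightarrow> bool) \<Rightarrow>
    ('n, 'k::zero) mpoly set \<Rightarrow> ('n, 'k) mpoly \<Rightarrow> 'n monomial \<Rightarrow> ('n, 'k) mpoly \<Rightarrow> bool" where
  "reduces_at L gt F f v p \<longleftrightarrow>
     v \<in> L (lm gt f) (lm gt ` F) \<and> Poly_Mapping.lookup p (lm gt f + v) \<noteq> 0"

definition reduct :: "('n monomial \<Rightarrow> 'n monomial \<Rightarrow> bool) \<Rightarrow>
    ('n, 'k::field) mpoly \<Rightarrow> 'n monomial \<Rightarrow> ('n, 'k) mpoly \<Rightarrow> ('n, 'k) mpoly" where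
  "reduct gt f v p =
     p - Poly_Mapping.single v (Poly_Mapping.lookup p (lm gt f + v) / lc gt f) * f"

definition inv_reducible :: "'n division \<Rightarrow> ('n monomial \<Rightarrow> 'n monomial \<Rightarrow> bool) \<Rightarrow>
    ('n, 'k::zero) mpoly set \<Rightarrow> ('n, 'k) mpoly \<Rightarrow> ('n, 'k) mpoly \<Rightarrow> bool" where
  "inv_reducible L gt F f p \<longleftrightarrow> (\<exists>v. reduces_at L gt F f v p)"

definition inv_reduction :: "'n division \<Rightarrow> ('n monomial \<Rightarrow> 'n monomial \<Rightarrow> bool) \<Rightarrow>
    ('n, 'k::field) mpoly set \<Rightarrow> ('n, 'k) mpoly \<Rightarrow> ('n, 'k) mpoly \<Rightarrow> bool" where
  "inv_reduction L gt F p q \<longleftrightarrow>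
     (\<exists>f\<in>F. \<exists>v. reduces_at L gt F f v p \<and> q = reduct gt f v p)"

definition in_normal_form :: "'n division \<Rightarrow> ('n monomial \<Rightarrow> 'n monomial \<Rightarrow> bool) \<Rightarrow>
    ('n, 'k::zero) mpoly set \<Rightarrow> ('n, 'k) mpoly \<Rightarrow> bool" where
  "in_normal_form L gt F p \<longleftrightarrow> (\<forall>f\<in>F. \<not> inv_reducible L gt F f p)"

text \<open>
  \<open>is_NF L gt F p h\<close>: \<open>h\<close> is a possible value of \<open>NF\<^sub>L(p,F)\<close>. Being a relation rather than a
  function, it leaves the choice of the chain of reductions, i.e. the algorithm, arbitrary.
\<close>

definition is_NF :: "'n division \<Rightarrow> ('n monomial \<Rightarrow> 'n monomial \<Rightarrow> bool) \<Rightarrow>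
    ('n, 'k::field) mpoly set \<Rightarrow> ('n, 'k) mpoly \<Rightarrow> ('n, 'k) mpoly \<Rightarrow> bool" where
  "is_NF L gt F p h \<longleftrightarrow> (inv_reduction L gt F)\<^sup>*\<^sup>* p h \<and> in_normal_form L gt F h"

end

theory Submission
  imports Defs
begin

text \<open>
  Every reduction step subtracts from \<open>p\<close> a scalar multiple of an involutive multiple \<open>v f\<close>, where
  \<open>f \<in> F\<close> and \<open>v \<in> L(lm f, lm F)\<close>. So \<open>p\<close> and each of its normal forms differ by an element of the
  \<open>K\<close>-linear span of the involutive multiples of \<open>F\<close>. Both parts of the theorem then follow from
  one fact: the only element of that span in normal form is \<open>0\<close>. It is applied to
  \<open>h\<^sub>1 - h\<^sub>2\<close> for uniqueness and to \<open>h - (h\<^sub>1 + h\<^sub>2)\<close> for linearity; these are again in normal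
  form, because being in normal form only requires the coefficients at all monomials of the
  involutive cone to vanish, which is a linear condition.

  The fact holds because distinct involutive multiples have distinct leading monomials: \<open>lm (v f)\<close>
  lies in the cone of \<open>lm f\<close>, and axiom (b) of an involutive division makes the cones of
  an autoreduced set pairwise disjoint. A family of nonzero polynomials with distinct leading
  monomials is in echelon form, so the leading monomial of a nonzero linear combination is that
  of a member of the family. Here this monomial lies in the involutive cone, and a polynomial
  containing it is reducible.
\<close>

section \<open>Polynomials as a vector space\<close>

text \<open>
  Everything below happens in a linear span over \<open>K\<close>. Letting scalars act through constant
  polynomials keeps a scaled multiple of \<open>f\<close> of the form \<open>c v f\<close>, a term times \<open>f\<close>, so
  the coefficient formula for such products applies to it directly.
\<close>

interpretation mpoly: vector_space
  "\<lambda>(k::'k::field) (p::('n, 'k) mpoly). Poly_Mapping.single 0 k * p"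
proof
  fix a b :: 'k and p q :: "('n, 'k) mpoly"
  show "Poly_Mapping.single 0 a * (p + q) = Poly_Mapping.single 0 a * p + Poly_Mapping.single 0 a * q"
    by (rule distrib_left)
  show "Poly_Mapping.single 0 (a + b) * p = Poly_Mapping.single 0 a * p + Poly_Mapping.single 0 b * p"
    by (simp only: single_add distrib_right)
  show "Poly_Mapping.single 0 a * (Poly_Mapping.single 0 b * p) = Poly_Mapping.single 0 (a * b) * p"
    by (simp only: mult_single add_0 flip: mult.assoc)
  show "Poly_Mapping.single 0 1 * p = p"
    by (simp only: single_one mult_1)
qed

lemma lookup_single_times:
  fixes f :: "('n, 'k::semiring_0) mpoly"
  shows "Poly_Mapping.lookup (Poly_Mapping.single v c * f) (v + u) = c * Poly_Mapping.lookup f u"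
proof -
  have "Poly_Mapping.lookup (Poly_Mapping.single v c * f) (v + u)
        = Sum_any (\<lambda>l. c * Sum_any (\<lambda>q. Poly_Mapping.lookup f q when v + u = l + q) when l = v)"
    unfolding lookup_mult by (rule Sum_any.cong) (simp add: lookup_single when_def)
  then show ?thesis
    by simp
qed

lemma keys_single_timesE:
  assumes "w \<in> Poly_Mapping.keys (Poly_Mapping.single v c * f)"
  obtains u where "w = v + u" "u \<in> Poly_Mapping.keys f"
proof -
  obtain a u where "w = a + u" "a \<in> Poly_Mapping.keys (Poly_Mapping.single v c)"
    "u \<in> Poly_Mapping.keys f"
    using assms keys_mult[of "Poly_Mapping.single v c" f] by blast
  with that show ?thesis
    by (simp split: if_splits)
qed


section \<open>Leading monomials\<close>

lemma admissible_ordering_asym: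
  assumes "admissible_ordering gt" "gt u v" "gt v u"
  shows False
proof -
  have "irreflp gt" "transp gt"
    using assms(1) by (simp_all add: admissible_ordering_def)
  then show False
    using transpD[OF \<open>transp gt\<close> assms(2,3)] by (simp add: irreflp_def)
qed

lemma lm_eqI:
  assumes "admissible_ordering gt" "u \<in> Poly_Mapping.keys f"
    and "\<And>v. v \<in> Poly_Mapping.keys f \<Longrightarrow> v \<noteq> u \<Longrightarrow> gt u v"
  shows "lm gt f = u"
  unfolding lm_def
proof (rule the_equality)
  fix w assume w: "w \<in> Poly_Mapping.keys f \<and> (\<forall>v\<in>Poly_Mapping.keys f. v \<noteq> w \<longrightarrow> gt w v)"
  show "w = u"
  proof (rule ccontr)
    assume "w \<noteq> u"
    with w assms(2,3) have "gt u w" "gt w u"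
      by auto
    then show False
      by (rule admissible_ordering_asym[OF assms(1)])
  qed
qed (use assms(2,3) in simp)

lemma greatest_exists:
  assumes "admissible_ordering gt" "finite A" "A \<noteq> {}"
  obtains u where "u \<in> A" "\<And>v. v \<in> A \<Longrightarrow> v \<noteq> u \<Longrightarrow> gt u v"
proof -
  have tra: "transp gt" and tot: "totalp gt"
    using assms(1) by (simp_all add: admissible_ordering_def)
  have "asymp_on A (\<lambda>x y. gt y x)"
    using admissible_ordering_asym[OF assms(1)] by (auto intro: asymp_onI)
  moreover have "transp_on A (\<lambda>x y. gt y x)"
  proof (rule transp_onI)
    fix x y z assume "gt y x" "gt z y"
    then show "gt z x"
      using transpD[OF tra, of z y x] by simp
  qed
  ultimately have "\<exists>u\<in>A. \<forall>v\<in>A. v \<noteq> u \<longrightarrow> \<not> gt v u"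
    using Finite_Set.bex_max_element[OF assms(2) _ _ assms(3), of "\<lambda>x y. gt y x"] by simp
  then obtain u where u: "u \<in> A" "\<forall>v\<in>A. v \<noteq> u \<longrightarrow> \<not> gt v u"
    by (elim bexE)
  have "gt u v" if "v \<in> A" "v \<noteq> u" for v
    using that u totalp_onD[OF tot, of u v] by blast
  with u(1) show ?thesis
    by (rule that)
qed

lemma
  assumes "admissible_ordering gt" "f \<noteq> 0"
  shows lm_in_keys: "lm gt f \<in> Poly_Mapping.keys f"
    and lm_greatest: "v \<in> Poly_Mapping.keys f \<Longrightarrow> v \<noteq> lm gt f \<Longrightarrow> gt (lm gt f) v"
proof -
  obtain u where u: "u \<in> Poly_Mapping.keys f" "\<And>v. v \<in> Poly_Mapping.keys f \<Longrightarrow> v \<noteq> u \<Longrightarrow> gt u v"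
    using greatest_exists[OF assms(1), of "Poly_Mapping.keys f"] assms(2) by auto
  then have "lm gt f = u"
    by (rule lm_eqI[OF assms(1)])
  with u show "lm gt f \<in> Poly_Mapping.keys f"
    "v \<in> Poly_Mapping.keys f \<Longrightarrow> v \<noteq> lm gt f \<Longrightarrow> gt (lm gt f) v"
    by auto
qed

lemma lm_single_times:
  fixes f :: "('n, 'k::field) mpoly"
  assumes "admissible_ordering gt" "f \<noteq> 0" "c \<noteq> 0"
  shows "lm gt (Poly_Mapping.single v c * f) = lm gt f + v"
proof (rule lm_eqI[OF assms(1)])
  show "lm gt f + v \<in> Poly_Mapping.keys (Poly_Mapping.single v c * f)"
    using lm_in_keys[OF assms(1,2)] lookup_single_times[of v c f "lm gt f"] assms(3)
    by (simp add: in_keys_iff add.commute)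
next
  fix w assume "w \<in> Poly_Mapping.keys (Poly_Mapping.single v c * f)" "w \<noteq> lm gt f + v"
  then obtain u where u: "w = v + u" "u \<in> Poly_Mapping.keys f" "u \<noteq> lm gt f"
    by (metis keys_single_timesE add.commute)
  then have "gt (lm gt f) u"
    using lm_greatest[OF assms(1,2)] by blast
  then show "gt (lm gt f + v) w"
    using assms(1) u by (simp add: admissible_ordering_def add.commute[of v])
qed

lemma single_times_neq_0:
  fixes f :: "('n, 'k::field) mpoly"
  assumes "f \<noteq> 0" "c \<noteq> 0"
  shows "Poly_Mapping.single v c * f \<noteq> 0"
proof -
  obtain u where "Poly_Mapping.lookup f u \<noteq> 0"
    using assms(1) by (metis poly_mapping_eqI lookup_zero)
  with assms(2) lookup_single_times[of v c f u] show ?thesis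
    by auto
qed

text \<open>
  Echelon form: among the members that occur in a linear combination, the one with the greatest
  leading monomial contributes that monomial alone, so it cannot cancel.
\<close>

lemma span_distinct_lm_contains_lm:
  fixes B :: "('n, 'k::field) mpoly set"
  assumes gt: "admissible_ordering gt" and "0 \<notin> B" and inj: "inj_on (lm gt) B"
    and g: "g \<in> mpoly.span B" "g \<noteq> 0"
  obtains b where "b \<in> B" "lm gt b \<in> Poly_Mapping.keys g"
proof -
  obtain t r where t: "finite t" "t \<subseteq> B" and g_sum: "g = (\<Sum>b\<in>t. Poly_Mapping.single 0 (r b) * b)"
    using g(1) by (auto simp: mpoly.span_explicit)
  let ?A = "{b \<in> t. r b \<noteq> 0}"
  have "?A \<noteq> {}"
  proof
    assume "?A = {}"
    then have "g = 0"
      unfolding g_sum by (intro sum.neutral) auto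
    with g(2) show False ..
  qed
  then obtain m where "m \<in> lm gt ` ?A" and max: "\<And>w. w \<in> lm gt ` ?A \<Longrightarrow> w \<noteq> m \<Longrightarrow> gt m w"
    using greatest_exists[OF gt, of "lm gt ` ?A"] t(1) by auto
  then obtain b where b: "b \<in> t" "r b \<noteq> 0" "m = lm gt b"
    by auto
  have "Poly_Mapping.lookup (Poly_Mapping.single 0 (r c) * c) m = 0" if c: "c \<in> t - {b}" for c
  proof (cases "r c = 0")
    case False
    have "lm gt c \<noteq> m"
      using c b t(2) inj by (auto dest: inj_onD)
    then have less: "gt m (lm gt c)"
      using max c False by auto
    have "m \<notin> Poly_Mapping.keys c"
    proof
      assume "m \<in> Poly_Mapping.keys c"
      then have "gt (lm gt c) m"
        using lm_greatest[OF gt, of c m] \<open>lm gt c \<noteq> m\<close> c t(2) \<open>0 \<notin> B\<close> by auto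
      with less show False
        by (rule admissible_ordering_asym[OF gt])
    qed
    then show ?thesis
      using lookup_single_times[of 0 "r c" c m] by (simp add: in_keys_iff)
  qed simp
  then have "Poly_Mapping.lookup g m = Poly_Mapping.lookup (Poly_Mapping.single 0 (r b) * b) m"
    unfolding g_sum lookup_sum using t(1) b(1) by (simp add: sum.remove)
  also have "\<dots> = r b * Poly_Mapping.lookup b m"
    using lookup_single_times[of 0 "r b" b m] by simp
  also have "\<dots> \<noteq> 0"
    using lm_in_keys[OF gt, of b] b t(2) \<open>0 \<notin> B\<close> by (auto simp: in_keys_iff)
  finally have "m \<in> Poly_Mapping.keys g"
    by (simp add: in_keys_iff)
  with that b t(2) show ?thesis
    by blast
qed


section \<open>Involutive multiples of an autoreduced set\<close>

definition inv_multiples ::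
    "'n division \<Rightarrow> ('n monomial \<Rightarrow> 'n monomial \<Rightarrow> bool) \<Rightarrow> ('n, 'k::field) mpoly set \<Rightarrow> ('n, 'k) mpoly set" where
  "inv_multiples L gt F =
     {Poly_Mapping.single v 1 * f | f v. f \<in> F \<and> v \<in> L (lm gt f) (lm gt ` F)}"

text \<open>
  By axiom (b), overlapping cones would put one generator into the cone of the other, which is what
  autoreducedness forbids for distinct generators.
\<close>

lemma autoreduced_cones_disjoint:
  assumes "involutive_division L" "finite U" "autoreduced_monomials L U"
    and "u \<in> U" "v \<in> U" "w \<in> inv_cone L U u" "w \<in> inv_cone L U v"
  shows "u = v"
proof -
  have "inv_cone L U u \<inter> inv_cone L U v \<noteq> {} \<longrightarrow> u \<in> inv_cone L U v \<or> v \<in> inv_cone L U u"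
    using assms(1,2,4,5) by (simp add: involutive_division_def)
  with assms(6,7) have "u \<in> inv_cone L U v \<or> v \<in> inv_cone L U u"
    by blast
  with assms(3,4,5) show ?thesis
    by (auto simp: autoreduced_monomials_def)
qed

text \<open>
  The leading monomial of an involutive multiple \<open>v f\<close> determines \<open>lm f\<close>, by disjointness of the
  cones, hence \<open>f\<close>, by injectivity of \<open>lm\<close> on an autoreduced set, and then \<open>v\<close> by cancellation.
\<close>

lemma inv_multiples_distinct_lm:
  fixes F :: "('n, 'k::field) mpoly set"
  assumes L: "involutive_division L" and gt: "admissible_ordering gt" and F: "autoreduced L gt F"
  shows "inj_on (lm gt) (inv_multiples L gt F)"
proof (rule inj_onI)
  fix a b assume a: "a \<in> inv_multiples L gt F" and b: "b \<in> inv_multiples L gt F"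
    and eq: "lm gt a = lm gt b"
  from a obtain f v where f: "a = Poly_Mapping.single v 1 * f" "f \<in> F" "v \<in> L (lm gt f) (lm gt ` F)"
    unfolding inv_multiples_def by auto
  from b obtain h w where h: "b = Poly_Mapping.single w 1 * h" "h \<in> F" "w \<in> L (lm gt h) (lm gt ` F)"
    unfolding inv_multiples_def by auto
  have "f \<noteq> 0" "h \<noteq> 0"
    using F f h by (auto simp: autoreduced_def)
  with eq have sum_eq: "lm gt f + v = lm gt h + w"
    by (simp add: f(1) h(1) lm_single_times[OF gt])
  moreover have "lm gt f + v \<in> inv_cone L (lm gt ` F) (lm gt f)"
    "lm gt h + w \<in> inv_cone L (lm gt ` F) (lm gt h)"
    using f(3) h(3) by (auto simp: inv_cone_def)
  ultimately have "lm gt f = lm gt h"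
    using autoreduced_cones_disjoint[OF L, of "lm gt ` F"] F f(2) h(2) by (simp add: autoreduced_def)
  moreover from this have "f = h"
    using F f(2) h(2) by (auto simp: autoreduced_def dest: inj_onD)
  ultimately show "a = b"
    using sum_eq by (simp add: f(1) h(1))
qed


section \<open>Normal forms\<close>

text \<open>In this form the condition is visibly linear in \<open>p\<close>.\<close>

lemma in_normal_form_iff:
  "in_normal_form L gt F p \<longleftrightarrow>
     (\<forall>f\<in>F. \<forall>v\<in>L (lm gt f) (lm gt ` F). Poly_Mapping.lookup p (lm gt f + v) = 0)"
  unfolding in_normal_form_def inv_reducible_def reduces_at_def by blast

text \<open>
  A nonzero \<open>g\<close> in the span would contain the leading monomial \<open>lm f + v\<close> of an involutive multiple,
  and could be reduced there modulo \<open>f\<close>.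
\<close>

lemma normal_form_in_span_is_0:
  fixes F :: "('n, 'k::field) mpoly set"
  assumes L: "involutive_division L" and gt: "admissible_ordering gt" and F: "autoreduced L gt F"
    and g: "g \<in> mpoly.span (inv_multiples L gt F)" and nf: "in_normal_form L gt F g"
  shows "g = 0"
proof (rule ccontr)
  assume "g \<noteq> 0"
  have nonzero: "f \<noteq> 0" if "f \<in> F" for f
    using F that by (auto simp: autoreduced_def)
  have "0 \<notin> inv_multiples L gt F"
    using single_times_neq_0[OF nonzero] by (fastforce simp: inv_multiples_def)
  then obtain b where "b \<in> inv_multiples L gt F" "lm gt b \<in> Poly_Mapping.keys g"
    using span_distinct_lm_contains_lm[OF gt _ inv_multiples_distinct_lm[OF L gt F] g \<open>g \<noteq> 0\<close>]
    by blast
  then obtain f v where "f \<in> F" "v \<in> L (lm gt f) (lm gt ` F)" "lm gt f + v \<in> Poly_Mapping.keys g"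
    using lm_single_times[OF gt nonzero] by (fastforce simp: inv_multiples_def)
  with nf show False
    by (auto simp: in_normal_form_iff in_keys_iff)
qed

lemma reductions_diff_in_span:
  fixes F :: "('n, 'k::field) mpoly set"
  assumes "(inv_reduction L gt F)\<^sup>*\<^sup>* p h"
  shows "p - h \<in> mpoly.span (inv_multiples L gt F)"
  using assms
proof (induction rule: rtranclp_induct)
  case base
  show ?case
    by (simp add: mpoly.span_zero)
next
  case (step q r)
  then obtain f v where f: "f \<in> F" "v \<in> L (lm gt f) (lm gt ` F)" and r: "r = reduct gt f v q"
    by (auto simp: inv_reduction_def reduces_at_def)
  define c where "c = Poly_Mapping.lookup q (lm gt f + v) / lc gt f"
  have "Poly_Mapping.single v 1 * f \<in> inv_multiples L gt F"
    using f by (auto simp: inv_multiples_def)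
  then have "Poly_Mapping.single 0 c * (Poly_Mapping.single v 1 * f)
      \<in> mpoly.span (inv_multiples L gt F)"
    by (intro mpoly.span_scale mpoly.span_base)
  moreover have "q - r = Poly_Mapping.single 0 c * (Poly_Mapping.single v 1 * f)"
    by (simp add: r reduct_def c_def mult_single flip: mult.assoc)
  ultimately have "(p - q) + (q - r) \<in> mpoly.span (inv_multiples L gt F)"
    using step.IH by (metis mpoly.span_add)
  then show ?case
    by simp
qed

theorem corollary5p5:
  fixes L :: "'n::{finite,linorder} division"
    and gt :: "'n monomial \<Rightarrow> 'n monomial \<Rightarrow> bool"
    and F :: "('n, 'k::field_char_0) mpoly set"
  assumes "involutive_division L"
    and "admissible_ordering gt"
    and "variables_decreasing gt"
    and "autoreduced L gt F"
  shows "(\<forall>p h1 h2. is_NF L gt F p h1 \<longrightarrow> is_NF L gt F p h2 \<longrightarrow> h1 = h2) \<and>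
         (\<forall>p1 p2 h1 h2 h. is_NF L gt F p1 h1 \<longrightarrow> is_NF L gt F p2 h2 \<longrightarrow>
            is_NF L gt F (p1 + p2) h \<longrightarrow> h = h1 + h2)"
proof (intro conjI allI impI)
  let ?V = "mpoly.span (inv_multiples L gt F)"
  note zero = normal_form_in_span_is_0[OF assms(1,2,4)]
  have NF: "p - h \<in> ?V" "in_normal_form L gt F h" if "is_NF L gt F p h" for p h
    using that reductions_diff_in_span by (auto simp: is_NF_def)
  {
    fix p h1 h2
    assume h1: "is_NF L gt F p h1" and h2: "is_NF L gt F p h2"
    have "(p - h2) - (p - h1) \<in> ?V"
      by (rule mpoly.span_diff[OF NF(1)[OF h2] NF(1)[OF h1]])
    then have "h1 - h2 \<in> ?V"
      by simp
    moreover have "in_normal_form L gt F (h1 - h2)"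
      using NF(2)[OF h1] NF(2)[OF h2] by (simp add: in_normal_form_iff lookup_minus)
    ultimately show "h1 = h2"
      using zero by fastforce
  next
    fix p1 p2 h1 h2 h
    assume h1: "is_NF L gt F p1 h1" and h2: "is_NF L gt F p2 h2" and h: "is_NF L gt F (p1 + p2) h"
    have "(p1 - h1) + (p2 - h2) - (p1 + p2 - h) \<in> ?V"
      by (rule mpoly.span_diff[OF mpoly.span_add[OF NF(1)[OF h1] NF(1)[OF h2]] NF(1)[OF h]])
    then have "h - (h1 + h2) \<in> ?V"
      by (simp add: algebra_simps)
    moreover have "in_normal_form L gt F (h - (h1 + h2))"
      using NF(2)[OF h1] NF(2)[OF h2] NF(2)[OF h]
      by (simp add: in_normal_form_iff lookup_minus lookup_add)
    ultimately show "h = h1 + h2"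
      using zero by fastforce
  }
qed

end
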